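(* Let $s\ge2$ and consider the optimal $s$-stage second order SSP Runge--Kutta method $$Y_1=U_n,\qquad Y_j=Y_{j-1}+\frac{\tau}{s-1}F(Y_{j-1})\ (2\le j\le s),\qquad U_{n+1}=\frac1sU_n+\frac{s-1}{s}\Big(Y_s+\frac{\tau}{s-1}F(Y_s)\Big),$$ implemented in this form. Its maximum internal amplification factor satisfies $$\mathcal{M}_s^{\mathrm{SSP2}}\le\frac{s+1}{s}.$$
   Context: A Runge--Kutta method in Shu--Osher form is $$Y_i=v_iU_n+\sum_{j=1}^s\big(\alpha_{ij}Y_j+\tau\beta_{ij}F(Y_j)\big)\ (1\le i\le s+1),\qquad U_{n+1}=Y_{s+1}.$$ For the method in the claim the nonzero coefficients are $v_1=1$, $v_{s+1}=1/s$, $\alpha_{j,j-1}=1$ and $\beta_{j,j-1}=1/(s-1)$ for $2\le j\le s$, $\alpha_{s+1,s}=(s-1)/s$, $\beta_{s+1,s}=1/s$. Write $\alpha_{1:s},\beta_{1:s}$ for the upper-left $s\times s$ blocks, $\alpha_{s+1},\beta_{s+1}$ for the first $s$ entries of the last rows, and $v_{1:s}=(v_1,\dots,v_s)^\top$. The stability function is $P(z)=v_{s+1}+(\alpha_{s+1}+z\beta_{s+1})(I_s-\alpha_{1:s}-z\beta_{1:s})^{-1}v_{1:s}$ and the internal stability functions are $(Q_1(z),\dots,Q_s(z))=(\alpha_{s+1}+z\beta_{s+1})(I_s-\alpha_{1:s}-z\beta_{1:s})^{-1}$. The maximum internal amplification factor is $\mathcal{M}=\max_{1\le j\le s}\sup_{z\in\mathcal{S}}|Q_j(z)|$,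 where $\mathcal{S}=\{z\in\mathbb{C}:|P(z)|\le1\}$ is the absolute stability region; for the optimal $s$-stage second order SSP Runge--Kutta method $Y_1=U_n$, $Y_j=Y_{j-1}+\frac{\tau}{s-1}F(Y_{j-1})$ $(2\le j\le s)$, $U_{n+1}=\frac1sU_n+\frac{s-1}{s}\big(Y_s+\frac{\tau}{s-1}F(Y_s)\big)$, implemented in this form, it is denoted $\mathcal{M}_s^{\mathrm{SSP2}}$. *)

theory Defs
  imports
    Complex_Main
    "HOL-Library.Extended_Real"
    "Jordan_Normal_Form.Determinant"
    "Jordan_Normal_Form.Gauss_Jordan_Elimination"
begin

text \<open>The coefficient functions are indexed from 1, with indices \<open>1, \<dots>, s + 1\<close> for the rows
  and \<open>1, \<dots>, s\<close> for the columns, where \<open>s\<close> is the number of stages.\<close>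

record shu_osher =
  stages :: nat
  so_v :: "nat \<Rightarrow> real"
  so_\<alpha> :: "nat \<Rightarrow> nat \<Rightarrow> real"
  so_\<beta> :: "nat \<Rightarrow> nat \<Rightarrow> real"

definition shu_osher_step ::
  "shu_osher \<Rightarrow> ('a::real_vector \<Rightarrow> 'a) \<Rightarrow> real \<Rightarrow> 'a \<Rightarrow> (nat \<Rightarrow> 'a) \<Rightarrow> 'a \<Rightarrow> bool" where
  "shu_osher_step R F \<tau> U Y U' \<longleftrightarrow>
     (\<forall>i\<in>{1..stages R + 1}. Y i = so_v R i *\<^sub>R U +
        (\<Sum>j=1..stages R. so_\<alpha> R i j *\<^sub>R Y j + (\<tau> * so_\<beta> R i j) *\<^sub>R F (Y j))) \<and>
     U' = Y (stages R + 1)"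

text \<open>The matrix \<open>I - \<alpha> - z \<beta>\<close> for the upper-left \<open>s \<times> s\<close> blocks, the vector of the first \<open>s\<close>
  entries of the last row of \<open>\<alpha> + z \<beta>\<close>, and \<open>(v\<^sub>1, \<dots>, v\<^sub>s)\<close>. Matrices and vectors of the library
  are indexed from 0, hence the shifts.\<close>

definition stage_mat :: "shu_osher \<Rightarrow> complex \<Rightarrow> complex mat" where
  "stage_mat R z =
     1\<^sub>m (stages R)
     - mat (stages R) (stages R) (\<lambda>(i, j). of_real (so_\<alpha> R (i + 1) (j + 1)))
     - z \<cdot>\<^sub>m mat (stages R) (stages R) (\<lambda>(i, j). of_real (so_\<beta> R (i + 1) (j + 1)))"

definition last_row :: "shu_osher \<Rightarrow> complex \<Rightarrow> complex vec" where
  "last_row R z =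
     vec (stages R) (\<lambda>j. of_real (so_\<alpha> R (stages R + 1) (j + 1)))
     + z \<cdot>\<^sub>v vec (stages R) (\<lambda>j. of_real (so_\<beta> R (stages R + 1) (j + 1)))"

definition v_vec :: "shu_osher \<Rightarrow> complex vec" where
  "v_vec R = vec (stages R) (\<lambda>i. of_real (so_v R (i + 1)))"

text \<open>The row vector \<open>(\<alpha>\<^sub>s\<^sub>+\<^sub>1 + z \<beta>\<^sub>s\<^sub>+\<^sub>1) (I - \<alpha> - z \<beta>)\<^sup>-\<^sup>1\<close>, written as the transposed inverse acting
  on a vector; meaningful only when the matrix is invertible.\<close>

definition internal_stability_vec :: "shu_osher \<Rightarrow> complex \<Rightarrow> complex vec" where
  "internal_stability_vec R z = transpose_mat (the (mat_inverse (stage_mat R z))) *\<^sub>v last_row R z"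

definition internal_stability :: "shu_osher \<Rightarrow> nat \<Rightarrow> complex \<Rightarrow> complex" where
  "internal_stability R j z = internal_stability_vec R z $ (j - 1)"

definition stability_fun :: "shu_osher \<Rightarrow> complex \<Rightarrow> complex" where
  "stability_fun R z =
     of_real (so_v R (stages R + 1)) + internal_stability_vec R z \<bullet> v_vec R"

text \<open>Points at which the stability function is undefined (possible only for implicit methods)
  do not belong to the stability region.\<close>

definition stability_region :: "shu_osher \<Rightarrow> complex set" where
  "stability_region R = {z. invertible_mat (stage_mat R z) \<and> cmod (stability_fun R z) \<le> 1}"

text \<open>The supremum is taken in the extended reals, so that an unbounded \<open>Q\<^sub>j\<close> gives \<open>\<infinity>\<close>.\<close>

definition max_internal_amplification :: "shu_osher \<Rightarrow> ereal" where
  "max_internal_amplification R =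
     Max ((\<lambda>j. SUP z\<in>stability_region R. ereal (cmod (internal_stability R j z))) ` {1..stages R})"

definition ssp2 :: "nat \<Rightarrow> shu_osher" where
  "ssp2 s = \<lparr>
     stages = s,
     so_v = (\<lambda>i. if i = 1 then 1 else if i = s + 1 then 1 / real s else 0),
     so_\<alpha> = (\<lambda>i j. if 2 \<le> i \<and> i \<le> s \<and> j = i - 1 then 1
                    else if i = s + 1 \<and> j = s then (real s - 1) / real s else 0),
     so_\<beta> = (\<lambda>i j. if 2 \<le> i \<and> i \<le> s \<and> j = i - 1 then 1 / (real s - 1)
                    else if i = s + 1 \<and> j = s then 1 / real s else 0)\<rparr>"

lemma ssp2_step_iff:
  assumes "s \<ge> 2"
  shows "shu_osher_step (ssp2 s) F \<tau> U Y U' \<longleftrightarrow>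
     Y 1 = U \<and>
     (\<forall>j\<in>{2..s}. Y j = Y (j - 1) + (\<tau> / (real s - 1)) *\<^sub>R F (Y (j - 1))) \<and>
     U' = (1 / real s) *\<^sub>R U +
          ((real s - 1) / real s) *\<^sub>R (Y s + (\<tau> / (real s - 1)) *\<^sub>R F (Y s)) \<and>
     Y (s + 1) = U'"
proof -
  define G where "G i = so_v (ssp2 s) i *\<^sub>R U +
    (\<Sum>j=1..s. so_\<alpha> (ssp2 s) i j *\<^sub>R Y j + (\<tau> * so_\<beta> (ssp2 s) i j) *\<^sub>R F (Y j))" for i
  have single: "(\<Sum>j=1..s. a j *\<^sub>R Y j + (\<tau> * b j) *\<^sub>R F (Y j)) = a k *\<^sub>R Y k + (\<tau> * b k) *\<^sub>R F (Y k)"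
    if "k \<in> {1..s}" "\<And>j. j \<noteq> k \<Longrightarrow> a j = 0 \<and> b j = 0" for k and a b :: "nat \<Rightarrow> real"
  proof -
    have "(\<Sum>j\<in>{1..s}. a j *\<^sub>R Y j + (\<tau> * b j) *\<^sub>R F (Y j)) =
          (\<Sum>j\<in>{k}. a j *\<^sub>R Y j + (\<tau> * b j) *\<^sub>R F (Y j))"
      by (rule sum.mono_neutral_right) (use that in auto)
    then show ?thesis by simp
  qed
  have G1: "G 1 = U"
    using assms by (simp add: G_def ssp2_def)
  have Gj: "G j = Y (j - 1) + (\<tau> / (real s - 1)) *\<^sub>R F (Y (j - 1))" if "j \<in> {2..s}" for j
    unfolding G_def
    by (subst single[of "j - 1"]) (use that in \<open>auto simp: ssp2_def\<close>)
  have Gs: "G (s + 1) = (1 / real s) *\<^sub>R U +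
          ((real s - 1) / real s) *\<^sub>R (Y s + (\<tau> / (real s - 1)) *\<^sub>R F (Y s))"
    unfolding G_def
    by (subst single[of s]) (use assms in \<open>auto simp: ssp2_def scaleR_add_right\<close>)
  have "{1..s + 1} = insert 1 (insert (s + 1) {2..s})"
    using assms by auto
  then have all: "(\<forall>i\<in>{1..s + 1}. Y i = G i) \<longleftrightarrow>
      Y 1 = G 1 \<and> (\<forall>j\<in>{2..s}. Y j = G j) \<and> Y (s + 1) = G (s + 1)"
    by auto
  have mid: "(\<forall>j\<in>{2..s}. Y j = G j) \<longleftrightarrow>
      (\<forall>j\<in>{2..s}. Y j = Y (j - 1) + (\<tau> / (real s - 1)) *\<^sub>R F (Y (j - 1)))"
    using Gj by auto
  have step: "shu_osher_step (ssp2 s) F \<tau> U Y U' \<longleftrightarrow>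
      (\<forall>i\<in>{1..s + 1}. Y i = G i) \<and> U' = Y (s + 1)"
    unfolding shu_osher_step_def G_def by (simp add: ssp2_def)
  show ?thesis
    unfolding step all mid G1 Gs by metis
qed

lemma invertible_stage_mat_ssp2: "invertible_mat (stage_mat (ssp2 s) z)"
proof -
  let ?A = "stage_mat (ssp2 s) z"
  have A: "?A \<in> carrier_mat s s"
    unfolding stage_mat_def by (intro carrier_matI) (simp_all add: ssp2_def)
  have "det ?A = prod_list (diag_mat ?A)"
    by (rule det_lower_triangular[OF _ A]) (auto simp: stage_mat_def ssp2_def)
  also have "\<dots> = 1"
    unfolding prod_list_diag_prod by (rule prod.neutral) (auto simp: stage_mat_def ssp2_def)
  finally have "det ?A \<noteq> 0" by simp
  from det_non_zero_imp_unit[OF A this, of "()"]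
  obtain B where "B \<in> carrier_mat s s" "B * ?A = 1\<^sub>m s" "?A * B = 1\<^sub>m s"
    by (auto simp: Units_def ring_mat_def)
  then show ?thesis
    using A unfolding invertible_mat_def inverts_mat_def by (auto intro!: exI[of _ B])
qed

end

theory Submission
  imports Defs
begin

text \<open>Put \<open>w = 1 + z / (s - 1)\<close>, the factor by which one Euler stage multiplies the solution of the
  linear test equation. Any perturbation of stage \<open>j\<close> passes through the \<open>s - j\<close> later stages and
  through the last row, whose final entry is \<open>(s - 1) / s * w\<close>, so that
  \<open>Q\<^sub>j(z) = (s - 1) / s * w ^ (s + 1 - j)\<close> and \<open>P(z) = 1 / s + (s - 1) / s * w ^ s\<close>.

  On the stability region, \<open>cmod (P z) \<le> 1\<close> and the triangle inequality give
  \<open>(s - 1) / s * cmod w ^ s \<le> 1 + 1 / s\<close>. This is already the bound on \<open>Q\<^sub>1\<close>. The exponents that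
  occur in the other \<open>Q\<^sub>j\<close> lie between \<open>1\<close> and \<open>s\<close>: if \<open>cmod w \<ge> 1\<close>, the power \<open>w ^ s\<close> dominates
  them all; if \<open>cmod w \<le> 1\<close>, every \<open>Q\<^sub>j\<close> has modulus below \<open>1\<close>.\<close>

text \<open>Transposing turns the row vector \<open>(\<alpha>\<^sub>s\<^sub>+\<^sub>1 + z \<beta>\<^sub>s\<^sub>+\<^sub>1) (I - \<alpha> - z \<beta>)\<^sup>-\<^sup>1\<close> into the unique
  solution of a linear system, so a guessed solution need only be substituted and no inverse has to
  be computed.\<close>

lemma internal_stability_vec_eqI:
  assumes inv: "invertible_mat (stage_mat R z)"
    and q: "q \<in> carrier_vec (stages R)"
    and sys: "transpose_mat (stage_mat R z) *\<^sub>v q = last_row R z"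
  shows "internal_stability_vec R z = q"
proof -
  let ?A = "stage_mat R z" and ?n = "stages R"
  have A: "?A \<in> carrier_mat ?n ?n"
    unfolding stage_mat_def by (intro carrier_matI) simp_all
  obtain B where B: "mat_inverse ?A = Some B"
  proof (cases "mat_inverse ?A")
    case None
    from inv obtain C where C: "?A * C = 1\<^sub>m ?n" "C * ?A = 1\<^sub>m (dim_row C)"
      using A unfolding invertible_mat_def inverts_mat_def by auto
    have "dim_col C = ?n"
      using arg_cong[OF C(1), of dim_col] by simp
    moreover have "dim_row C = ?n"
      using arg_cong[OF C(2), of dim_col] A by simp
    ultimately have "C \<in> carrier_mat ?n ?n" by auto
    with A C have "?A \<in> Units (ring_mat TYPE(complex) ?n ())"
      by (auto simp: Units_def ring_mat_def)
    with mat_inverse(1)[OF A None, of "()"] show ?thesis by blast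
  qed (use that in blast)
  note B' = mat_inverse(2)[OF A B]
  have "internal_stability_vec R z = transpose_mat B *\<^sub>v (transpose_mat ?A *\<^sub>v q)"
    unfolding internal_stability_vec_def by (simp add: B sys)
  also have "\<dots> = (transpose_mat B * transpose_mat ?A) *\<^sub>v q"
    using A B' q by (intro assoc_mult_mat_vec[symmetric]) auto
  also have "transpose_mat B * transpose_mat ?A = transpose_mat (?A * B)"
    using A B' by (intro transpose_mult[symmetric]) auto
  finally show ?thesis
    using B' q by simp
qed

definition euler_factor :: "nat \<Rightarrow> complex \<Rightarrow> complex" where
  "euler_factor s z = 1 + z / of_real (real s - 1)"

lemma internal_stability_vec_ssp2:
  assumes s: "s \<ge> 2"
  shows "internal_stability_vec (ssp2 s) z =
    vec s (\<lambda>i. of_real ((real s - 1) / real s) * euler_factor s z ^ (s - i))" (is "_ = ?q")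
proof (rule internal_stability_vec_eqI[OF invertible_stage_mat_ssp2])
  let ?w = "euler_factor s z"
  have st: "stages (ssp2 s) = s" by (simp add: ssp2_def)
  show "?q \<in> carrier_vec (stages (ssp2 s))" by (simp add: st)
  have A: "stage_mat (ssp2 s) z \<in> carrier_mat s s"
    unfolding stage_mat_def by (intro carrier_matI) (simp_all add: st)
  have entry: "stage_mat (ssp2 s) z $$ (i, j) =
      (if i = j then 1 else if i = Suc j then - ?w else 0)" if "i < s" "j < s" for i j
    using that by (auto simp: stage_mat_def ssp2_def euler_factor_def)
  show "transpose_mat (stage_mat (ssp2 s) z) *\<^sub>v ?q = last_row (ssp2 s) z"
  proof (rule eq_vecI)
    show "dim_vec (transpose_mat (stage_mat (ssp2 s) z) *\<^sub>v ?q) = dim_vec (last_row (ssp2 s) z)"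
      using A by (simp add: last_row_def st)
  next
    fix j assume "j < dim_vec (last_row (ssp2 s) z)"
    then have j: "j < s" by (simp add: last_row_def st)
    have "(transpose_mat (stage_mat (ssp2 s) z) *\<^sub>v ?q) $ j =
        (\<Sum>i<s. stage_mat (ssp2 s) z $$ (i, j) * ?q $ i)"
      using A j by (simp add: scalar_prod_def lessThan_atLeast0)
    also have "\<dots> = (\<Sum>i<s. (if i = j then ?q $ i else 0) + (if i = Suc j then - ?w * ?q $ i else 0))"
      by (intro sum.cong refl) (simp add: entry j del: index_vec)
    also have "\<dots> = ?q $ j + (if Suc j < s then - ?w * ?q $ Suc j else 0)"
      using j by (simp add: sum.distrib del: index_vec)
    also have "\<dots> = last_row (ssp2 s) z $ j"
    proof (cases "Suc j < s")
      case True
      \<comment> \<open>\<open>q\<^sub>j = w * q\<^sub>j\<^sub>+\<^sub>1\<close> makes the two terms cancel.\<close>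
      then have "s - j = Suc (s - Suc j)" by simp
      then show ?thesis
        using True by (simp add: last_row_def ssp2_def)
    next
      case False
      with j have sj: "s = Suc j" by simp
      have "of_real ((real s - 1) / real s) * ?w =
          of_real ((real s - 1) / real s) + z * of_real (1 / real s)"
        using s unfolding euler_factor_def by (simp add: field_simps)
      with sj j show ?thesis
        by (simp add: last_row_def ssp2_def)
    qed
    finally show "(transpose_mat (stage_mat (ssp2 s) z) *\<^sub>v ?q) $ j = last_row (ssp2 s) z $ j" .
  qed
qed

lemma internal_stability_ssp2:
  assumes "s \<ge> 2" "1 \<le> j" "j \<le> s"
  shows "internal_stability (ssp2 s) j z =
    of_real ((real s - 1) / real s) * euler_factor s z ^ (s + 1 - j)"
proof -
  have "s - (j - 1) = s + 1 - j" "j - 1 < s" using assms by auto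
  then show ?thesis
    by (simp add: internal_stability_def internal_stability_vec_ssp2[OF assms(1)] del: One_nat_def)
qed

lemma stability_fun_ssp2:
  assumes s: "s \<ge> 2"
  shows "stability_fun (ssp2 s) z =
    of_real (1 / real s) + of_real ((real s - 1) / real s) * euler_factor s z ^ s"
proof -
  let ?q = "\<lambda>i. of_real ((real s - 1) / real s) * euler_factor s z ^ (s - i)"
  have "internal_stability_vec (ssp2 s) z \<bullet> v_vec (ssp2 s) = (\<Sum>i<s. ?q i * (if i = 0 then 1 else 0))"
    unfolding internal_stability_vec_ssp2[OF s]
    by (auto simp: scalar_prod_def v_vec_def ssp2_def lessThan_atLeast0 intro!: sum.cong)
  also have "\<dots> = (\<Sum>i<s. if i = 0 then ?q i else 0)"
    by (intro sum.cong) auto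
  also have "\<dots> = ?q 0"
    using s by simp
  finally show ?thesis
    unfolding stability_fun_def using s by (simp add: ssp2_def)
qed

lemma cmod_internal_stability_ssp2_le:
  assumes s: "s \<ge> 2" and j: "1 \<le> j" "j \<le> s" and z: "z \<in> stability_region (ssp2 s)"
  shows "cmod (internal_stability (ssp2 s) j z) \<le> (real s + 1) / real s"
proof -
  let ?c = "(real s - 1) / real s" and ?w = "euler_factor s z"
  have c: "0 \<le> ?c" "?c \<le> 1" using s by auto
  have "of_real ?c * ?w ^ s = stability_fun (ssp2 s) z - of_real (1 / real s)"
    by (simp add: stability_fun_ssp2[OF s])
  then have "cmod (of_real ?c * ?w ^ s) \<le> cmod (stability_fun (ssp2 s) z) + cmod (of_real (1 / real s))"
    by (metis norm_triangle_ineq4)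
  also have "\<dots> \<le> 1 + 1 / real s"
    using z by (simp add: stability_region_def norm_divide)
  also have "\<dots> = (real s + 1) / real s"
    using s by (simp add: field_simps)
  finally have top: "?c * cmod ?w ^ s \<le> (real s + 1) / real s"
    using c(1) by (simp only: norm_mult norm_power norm_of_real abs_of_nonneg)
  have "cmod (internal_stability (ssp2 s) j z) = ?c * cmod ?w ^ (s + 1 - j)"
    unfolding internal_stability_ssp2[OF s j]
    using c(1) by (simp only: norm_mult norm_power norm_of_real abs_of_nonneg)
  also have "\<dots> \<le> (real s + 1) / real s"
  proof (cases "cmod ?w \<ge> 1")
    case True
    then have "cmod ?w ^ (s + 1 - j) \<le> cmod ?w ^ s"
      using j by (intro power_increasing) auto
    then show ?thesis
      using top c(1) by (meson mult_left_mono order_trans)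
  next
    case False
    then have "cmod ?w ^ (s + 1 - j) \<le> 1"
      by (intro power_le_one) auto
    then have "?c * cmod ?w ^ (s + 1 - j) \<le> 1"
      using c by (intro mult_le_one) auto
    also have "1 \<le> (real s + 1) / real s"
      using s by simp
    finally show ?thesis .
  qed
  finally show ?thesis .
qed

theorem theorem3p4:
  fixes s :: nat
  assumes "s \<ge> 2"
  shows "max_internal_amplification (ssp2 s) \<le> ereal ((real s + 1) / real s)"
proof -
  have "stages (ssp2 s) = s" by (simp add: ssp2_def)
  then show ?thesis
    unfolding max_internal_amplification_def using assms
    by (subst Max_le_iff) (auto intro!: SUP_least cmod_internal_stability_ssp2_le)
qed

end
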